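(* Let $V$ be a valuation domain with quotient field $K$ and valuation $v$, and let $E=\{s_\nu\}_{\nu\in\Lambda},F=\{t_\mu\}_{\mu\in\Lambda}\subset K$ be pseudo-stationary sequences with breadth $\delta_E$ and $\delta_F$, respectively. Then $E$ and $F$ are equivalent (i.e. $V_E=V_F$) if and only if $\delta_E=\delta_F=\delta$ and $v(s_\nu-t_\mu)\geq\delta$ for all $\nu,\mu\in\Lambda$.
   Context: $\Lambda$ is a well-ordered set without maximum. A sequence $E=\{s_\nu\}_{\nu\in\Lambda}\subset K$ is pseudo-stationary if $v(s_\nu-s_\mu)=v(s_{\nu'}-s_{\mu'})$ for all $\nu\neq\mu$, $\nu'\neq\mu'$ in $\Lambda$; the common value $\delta_E=v(s_\nu-s_\mu)$ ($\nu\neq\mu$) is the breadth of $E$. Put $V_E=\{\phi\in K(X)\mid \phi(s_\nu)\in V\text{ for all sufficiently large }\nu\in\Lambda\}$, a valuation domain of $K(X)$ extending $V$. $E$ and $F$ are called equivalent if $V_E=V_F$. *)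

theory Defs
  imports "HOL-Computational_Algebra.Computational_Algebra" "HOL-Library.Extended"
begin

text \<open>The quotient field \<open>K\<close> is the whole type \<open>'k\<close>; a valuation domain with quotient
  field \<open>K\<close> is a subring of \<open>K\<close> containing \<open>x\<close> or \<open>inverse x\<close> for every nonzero \<open>x\<close>
  (so that every element of \<open>K\<close> is a quotient of elements of the subring).
  The trivial case \<open>V = K\<close> is allowed.\<close>

definition valuation_domain :: "'k::field set \<Rightarrow> bool" where
  "valuation_domain V \<longleftrightarrow>
     0 \<in> V \<and> 1 \<in> V \<and>
     (\<forall>x\<in>V. \<forall>y\<in>V. x - y \<in> V \<and> x * y \<in> V) \<and>
     (\<forall>x. x \<noteq> 0 \<longrightarrow> x \<in> V \<or> inverse x \<in> V)"

text \<open>Valuations are written additively, with values in \<open>\<Gamma> \<union> {\<infinity>}\<close> for an arbitrary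
  linearly ordered abelian group \<open>\<Gamma>\<close> (the type \<open>'g\<close>). The library type \<open>extended\<close>
  also has an element \<open>-\<infinity>\<close>, which is excluded as a value.\<close>

definition valuation :: "('k::field \<Rightarrow> 'g::linordered_ab_group_add extended) \<Rightarrow> bool" where
  "valuation v \<longleftrightarrow>
     (\<forall>x. v x \<noteq> -\<infinity>) \<and>
     (\<forall>x. v x = \<infinity> \<longleftrightarrow> x = 0) \<and>
     (\<forall>x y. v (x * y) = v x + v y) \<and>
     (\<forall>x y. min (v x) (v y) \<le> v (x + y))"

definition valuation_of ::
    "'k::field set \<Rightarrow> ('k \<Rightarrow> 'g::linordered_ab_group_add extended) \<Rightarrow> bool" where
  "valuation_of V v \<longleftrightarrow> valuation v \<and> V = {x. 0 \<le> v x}"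

text \<open>Sequences are indexed by a type of class \<open>wellorder\<close> and \<open>no_top\<close>, i.e. by a
  (nonempty) well-ordered set without maximum.\<close>

definition pseudo_stationary ::
    "('k::field \<Rightarrow> 'g::linordered_ab_group_add extended) \<Rightarrow> ('i::{wellorder,no_top} \<Rightarrow> 'k) \<Rightarrow> bool"
  where
  "pseudo_stationary v s \<longleftrightarrow>
     (\<forall>\<nu> \<mu> \<nu>' \<mu>'. \<nu> \<noteq> \<mu> \<longrightarrow> \<nu>' \<noteq> \<mu>' \<longrightarrow> v (s \<nu> - s \<mu>) = v (s \<nu>' - s \<mu>'))"

definition breadth ::
    "('k::field \<Rightarrow> 'g::linordered_ab_group_add extended) \<Rightarrow> ('i::{wellorder,no_top} \<Rightarrow> 'k) \<Rightarrow> 'g extended"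
  where
  "breadth v s = (THE \<delta>. \<forall>\<nu> \<mu>. \<nu> \<noteq> \<mu> \<longrightarrow> v (s \<nu> - s \<mu>) = \<delta>)"

lemma breadth_eq:
  fixes s :: "'i::{wellorder,no_top} \<Rightarrow> 'k::field"
  assumes "pseudo_stationary v s" "\<nu> \<noteq> \<mu>"
  shows "breadth v s = v (s \<nu> - s \<mu>)"
  unfolding breadth_def
proof (rule the_equality)
  show "\<forall>\<nu>' \<mu>'. \<nu>' \<noteq> \<mu>' \<longrightarrow> v (s \<nu>' - s \<mu>') = v (s \<nu> - s \<mu>)"
    using assms unfolding pseudo_stationary_def by blast
next
  fix \<delta> assume "\<forall>\<nu> \<mu>. \<nu> \<noteq> \<mu> \<longrightarrow> v (s \<nu> - s \<mu>) = \<delta>"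
  with assms(2) show "\<delta> = v (s \<nu> - s \<mu>)" by blast
qed

text \<open>\<open>K(X)\<close> is the fraction field \<open>'k poly fract\<close>. A rational function is a partial
  function on \<open>K\<close>: \<open>ratfun_value \<phi> a y\<close> says that \<open>\<phi>\<close> is defined at \<open>a\<close> (some
  representation of \<open>\<phi>\<close> as a quotient has a denominator not vanishing at \<open>a\<close>) and that
  \<open>\<phi>(a) = y\<close>.\<close>

definition ratfun_value :: "'k::field poly fract \<Rightarrow> 'k \<Rightarrow> 'k \<Rightarrow> bool" where
  "ratfun_value \<phi> a y \<longleftrightarrow>
     (\<exists>p q. \<phi> = Fract p q \<and> poly q a \<noteq> 0 \<and> y = poly p a / poly q a)"

lemma ratfun_value_unique:
  assumes "ratfun_value \<phi> a y" "ratfun_value \<phi> a z"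
  shows "y = z"
proof -
  obtain p q p' q' where *: "\<phi> = Fract p q" "poly q a \<noteq> 0" "y = poly p a / poly q a"
      "\<phi> = Fract p' q'" "poly q' a \<noteq> 0" "z = poly p' a / poly q' a"
    using assms unfolding ratfun_value_def by blast
  then have "q \<noteq> 0" "q' \<noteq> 0" by auto
  with * have "p * q' = p' * q" by (metis eq_fract(1))
  then have "poly p a * poly q' a = poly p' a * poly q a" by (metis poly_mult)
  with * show ?thesis by (simp add: frac_eq_eq)
qed

definition seq_valuation_domain ::
    "'k::field set \<Rightarrow> ('i::{wellorder,no_top} \<Rightarrow> 'k) \<Rightarrow> 'k poly fract set" where
  "seq_valuation_domain V s =
     {\<phi>. \<forall>\<^sub>F \<nu> in at_top. \<exists>y. ratfun_value \<phi> (s \<nu>) y \<and> y \<in> V}"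

definition equivalent_seqs ::
    "'k::field set \<Rightarrow> ('i::{wellorder,no_top} \<Rightarrow> 'k) \<Rightarrow> ('i \<Rightarrow> 'k) \<Rightarrow> bool" where
  "equivalent_seqs V s t \<longleftrightarrow> seq_valuation_domain V s = seq_valuation_domain V t"

end

theory Submission
  imports Defs
begin

text \<open>For the converse direction, a polynomial of degree less than \<open>n\<close> is controlled on the whole
  ball of radius \<open>\<delta>\<close> by its values at any \<open>n\<close> points of the ball whose mutual distances are
  exactly \<open>\<delta>\<close>; hence its valuation is eventually constant along both sequences, with the same
  value, namely the minimum over the ball. No extension of \<open>v\<close> to an algebraic closure is
  needed. For the direct direction, the rational functions \<open>(X - a) / c\<close> and \<open>c / (X - a)\<close>
  show that \<open>V\<^sub>E\<close> determines, for every \<open>a\<close>, the eventual value of \<open>v (s \<nu> - a)\<close>, and taking for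
  \<open>a\<close> the terms of the sequences gives the claim.\<close>

section \<open>Elementary properties of a valuation\<close>

context
  fixes v :: "'k::field \<Rightarrow> 'g::linordered_ab_group_add extended"
  assumes v: "valuation v"
begin

lemma valuation_mult: "v (x * y) = v x + v y"
  using v by (simp add: valuation_def)

lemma valuation_eq_top_iff: "v x = \<infinity> \<longleftrightarrow> x = 0"
  using v by (simp add: valuation_def)

lemma valuation_0: "v 0 = \<infinity>"
  by (simp add: valuation_eq_top_iff)

lemma valuation_finite:
  assumes "x \<noteq> 0"
  obtains g where "v x = Fin g"
proof (cases "v x")
  case (Fin g)
  then show thesis by (rule that)
next
  case Pinf
  with assms show thesis by (simp add: valuation_eq_top_iff)
next
  case Minf
  with v show thesis by (simp add: valuation_def)
qed

lemma valuation_1: "v 1 = 0"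
proof -
  obtain g where g: "v 1 = Fin g" by (rule valuation_finite[of 1]) auto
  have "v 1 = v 1 + v 1" by (metis valuation_mult mult_1)
  with g show ?thesis by (simp add: zero_extended_def)
qed

lemma valuation_uminus: "v (- x) = v x"
proof -
  obtain g where g: "v (- 1) = Fin g" by (rule valuation_finite[of "- 1"]) auto
  have "v (- 1) + v (- 1) = 0"
    by (metis valuation_mult valuation_1 mult_minus1 minus_minus)
  \<comment> \<open>A linearly ordered group is torsion-free.\<close>
  with g have "g = 0" by (simp add: zero_extended_def)
  with g have "v (- 1) = 0" by (simp add: zero_extended_def)
  then show ?thesis by (metis valuation_mult mult_minus1 add_0)
qed

lemma valuation_minus_commute: "v (x - y) = v (y - x)"
  by (metis valuation_uminus minus_diff_eq)

lemma valuation_add_ge: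
  assumes "g \<le> v x" "g \<le> v y"
  shows "g \<le> v (x + y)"
  using v assms unfolding valuation_def by (meson min.boundedI order_trans)

lemma valuation_diff_ge:
  assumes "g \<le> v x" "g \<le> v y"
  shows "g \<le> v (x - y)"
  using valuation_add_ge[of g x "- y"] assms by (simp add: valuation_uminus)

lemma valuation_add_eq:
  assumes "v x < v y"
  shows "v (x + y) = v x"
proof (rule antisym)
  show "v x \<le> v (x + y)" using assms by (intro valuation_add_ge) auto
  show "v (x + y) \<le> v x"
  proof (rule ccontr)
    assume "\<not> v (x + y) \<le> v x"
    with assms have "min (v (x + y)) (v y) > v x" by simp
    moreover have "min (v (x + y)) (v y) \<le> v (x + y - y)"
      by (rule valuation_diff_ge) simp_all
    ultimately show False by (simp add: min_def split: if_splits)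
  qed
qed

lemma valuation_mult_mono:
  assumes "v a \<le> v b" "v x \<le> v y"
  shows "v (a * x) \<le> v (b * y)"
  unfolding valuation_mult by (rule add_mono[OF assms])

text \<open>The polynomial bounds below are carried by elements \<open>c\<close>, \<open>d\<close>
  of the field, so that \<open>c / d\<close> stands for a difference of bounds and no subtraction of
  extended values occurs.\<close>

lemma valuation_divide_le_iff:
  assumes "d \<noteq> 0"
  shows "v (c / d) \<le> v z \<longleftrightarrow> v c \<le> v (d * z)"
proof
  assume "v (c / d) \<le> v z"
  from valuation_mult_mono[OF order_refl this, of d] assms show "v c \<le> v (d * z)" by simp
next
  assume "v c \<le> v (d * z)"
  from valuation_mult_mono[OF order_refl this, of "inverse d"] assms show "v (c / d) \<le> v z"
    by (simp add: field_simps)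
qed

lemma valuation_divide_nonneg_iff:
  assumes "y \<noteq> 0"
  shows "0 \<le> v (x / y) \<longleftrightarrow> v y \<le> v x"
  using valuation_divide_le_iff[OF assms, of y "x / y"] assms by (simp add: valuation_1)

section \<open>Polynomials on a ball\<close>

text \<open>The induction on the degree divides \<open>p - p(a)\<close> by \<open>X - a\<close> for some \<open>a \<in> A\<close>.\<close>

lemma valuation_poly_ge_on_ball:
  assumes "finite A" "degree p < card A"
    and "\<And>a b. a \<in> A \<Longrightarrow> b \<in> A \<Longrightarrow> a \<noteq> b \<Longrightarrow> v (b - a) = v d"
    and "\<And>a. a \<in> A \<Longrightarrow> v d \<le> v (x - a)"
    and "d \<noteq> 0"
    and "\<And>a. a \<in> A \<Longrightarrow> v c \<le> v (poly p a)"
  shows "v c \<le> v (poly p x)"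
  using assms
proof (induction "degree p" arbitrary: p A c)
  case 0
  from 0 obtain a where "a \<in> A" by fastforce
  moreover from "0.hyps" have "poly p x = poly p a" by (metis degree_eq_zeroE poly_pCons poly_0 mult_zero_right)
  ultimately show ?case using 0 by simp
next
  case (Suc n)
  from Suc obtain a where a: "a \<in> A" by fastforce
  define q where "q = synthetic_div p a"
  have p: "poly p y = (y - a) * poly q y + poly p a" for y
    using arg_cong[OF synthetic_div_correct'[of a p], of "\<lambda>r. poly r y"]
    by (simp add: q_def algebra_simps)
  \<comment> \<open>At the points \<open>b\<close> other than \<open>a\<close>,
    \<open>poly q b\<close> is \<open>(p(b) - p(a)) / (b - a)\<close>, and the denominator has value
    \<open>v d\<close>, so the lower bound drops from \<open>v c\<close> to
    \<open>v (c / d)\<close>. Multiplying by \<open>x - a\<close>, of value at least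
    \<open>v d\<close>, restores it.\<close>
  have "v (c / d) \<le> v (poly q x)"
  proof (rule Suc.hyps(1))
    show "n = degree q" using Suc.hyps(2) by (simp add: q_def degree_synthetic_div)
    then show "degree q < card (A - {a})" using Suc.hyps(2) Suc.prems(2) a Suc.prems(1) by simp
    fix b assume b: "b \<in> A - {a}"
    have "v c \<le> v (poly p b - poly p a)"
      using b a Suc.prems(6) by (intro valuation_diff_ge) auto
    also have "poly p b - poly p a = (b - a) * poly q b" by (simp add: p[of b])
    also have "v \<dots> = v (d * poly q b)" using b a Suc.prems(3)[of a b] by (auto simp: valuation_mult)
    finally show "v (c / d) \<le> v (poly q b)" using Suc.prems(5) by (simp add: valuation_divide_le_iff)
  qed (use Suc.prems in auto)
  from valuation_mult_mono[OF Suc.prems(4)[OF a] this] Suc.prems(5)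
  have "v c \<le> v ((x - a) * poly q x)" by simp
  with Suc.prems(6)[OF a] show ?case by (subst p) (intro valuation_add_ge)
qed

lemma inj_if_const_distance:
  assumes "\<And>\<nu> \<mu>. \<nu> \<noteq> \<mu> \<Longrightarrow> v (s \<nu> - s \<mu>) = v d" "d \<noteq> 0"
  shows "inj s"
proof (rule injI, rule ccontr)
  fix \<nu> \<mu> assume "s \<nu> = s \<mu>" "\<nu> \<noteq> \<mu>"
  with assms(1)[of \<nu> \<mu>] have "v d = \<infinity>" by (simp add: valuation_0)
  with assms(2) show False by (simp add: valuation_eq_top_iff)
qed

text \<open>Among \<open>Suc (degree p)\<close> indices of \<open>N\<close>, take one with the least
  value of \<open>p\<close>. The previous bound, with \<open>c = poly p (s \<nu>)\<close>, spreads
  this minimum to all of \<open>B\<close>.\<close>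

lemma valuation_poly_min_on_ball:
  assumes s: "\<And>\<nu> \<mu>. \<nu> \<noteq> \<mu> \<Longrightarrow> v (s \<nu> - s \<mu>) = v d"
    and d: "d \<noteq> 0"
    and "infinite N"
    and B: "\<And>x \<nu>. x \<in> B \<Longrightarrow> v d \<le> v (x - s \<nu>)"
  obtains \<nu> where "\<nu> \<in> N" "\<And>x. x \<in> B \<Longrightarrow> v (poly p (s \<nu>)) \<le> v (poly p x)"
proof -
  obtain M where M: "M \<subseteq> N" "finite M" "card M = Suc (degree p)"
    using \<open>infinite N\<close> infinite_arbitrarily_large by blast
  then have "M \<noteq> {}" by auto
  with M(2) obtain \<nu> where \<nu>: "\<nu> \<in> M" "\<And>\<mu>. \<mu> \<in> M \<Longrightarrow> v (poly p (s \<nu>)) \<le> v (poly p (s \<mu>))"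
    using ex_min_if_finite[of "(\<lambda>\<mu>. v (poly p (s \<mu>))) ` M"] by (force simp: not_less)
  have "v (poly p (s \<nu>)) \<le> v (poly p x)" if "x \<in> B" for x
  proof (rule valuation_poly_ge_on_ball)
    show "degree p < card (s ` M)"
      using M inj_if_const_distance[of s d, OF s d] by (simp add: card_image inj_on_subset)
    show "v (b - a) = v d" if "a \<in> s ` M" "b \<in> s ` M" "a \<noteq> b" for a b
      using that by (metis s imageE)
  qed (use M \<nu> d B that in auto)
  with M(1) \<nu>(1) that show thesis by blast
qed

text \<open>If there were infinitely many exceptional indices, one of them would have a value of at
  most \<open>v (poly p a)\<close>, hence equal to it by minimality. So there are finitely many, and
  some index exceeds them all.\<close>

lemma eventually_valuation_poly_eq:
  fixes s :: "'i::{wellorder,no_top} \<Rightarrow> 'k"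
  assumes s: "\<And>\<nu> \<mu>. \<nu> \<noteq> \<mu> \<Longrightarrow> v (s \<nu> - s \<mu>) = v d"
    and d: "d \<noteq> 0"
    and a: "\<And>\<nu>. v d \<le> v (a - s \<nu>)"
    and min: "\<And>\<nu>. v (poly p a) \<le> v (poly p (s \<nu>))"
  shows "\<forall>\<^sub>F \<nu> in at_top. v (poly p (s \<nu>)) = v (poly p a)"
proof -
  define N where "N = {\<nu>. v (poly p (s \<nu>)) \<noteq> v (poly p a)}"
  have "finite N"
  proof (rule ccontr)
    assume "infinite N"
    then obtain \<nu> where "\<nu> \<in> N" "v (poly p (s \<nu>)) \<le> v (poly p a)"
      using valuation_poly_min_on_ball[of s d N "{a}" p] s d a by auto
    with min[of \<nu>] show False by (simp add: N_def)
  qed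
  \<comment> \<open>\<open>N\<close> may be empty; the inserted element gives \<open>Max\<close> a
    nonempty set.\<close>
  moreover obtain \<mu> where "Max (insert undefined N) < \<mu>" using gt_ex by blast
  ultimately have \<mu>: "\<forall>\<nu>\<in>N. \<nu> < \<mu>" by simp
  show ?thesis
    by (rule eventually_mono[OF eventually_ge_at_top[of \<mu>]]) (use \<mu> N_def in force)
qed

text \<open>The point \<open>a\<close> is a term of \<open>s\<close> at which
  \<open>v (poly p x)\<close> is minimal over both ranges; each sequence then eventually attains
  that minimum.\<close>

lemma eventually_valuation_poly_common:
  fixes s t :: "'i::{wellorder,no_top} \<Rightarrow> 'k"
  assumes s: "\<And>\<nu> \<mu>. \<nu> \<noteq> \<mu> \<Longrightarrow> v (s \<nu> - s \<mu>) = v d"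
    and t: "\<And>\<nu> \<mu>. \<nu> \<noteq> \<mu> \<Longrightarrow> v (t \<nu> - t \<mu>) = v d"
    and st: "\<And>\<nu> \<mu>. v d \<le> v (s \<nu> - t \<mu>)"
    and d: "d \<noteq> 0"
  obtains a where "p \<noteq> 0 \<Longrightarrow> poly p a \<noteq> 0"
    "\<forall>\<^sub>F \<nu> in at_top. v (poly p (s \<nu>)) = v (poly p a)"
    "\<forall>\<^sub>F \<nu> in at_top. v (poly p (t \<nu>)) = v (poly p a)"
proof (cases "p = 0")
  case True
  then show thesis by (intro that) simp_all
next
  case False
  \<comment> \<open>Searching for the minimum only among non-roots yields
    \<open>poly p a \<noteq> 0\<close>. Infinitely many indices remain, since \<open>s\<close> is
    injective and \<open>p\<close> has finitely many roots.\<close>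
  define N where "N = {\<nu>. poly p (s \<nu>) \<noteq> 0}"
  have "finite (s -` {x. poly p x = 0})"
    using inj_if_const_distance[of s d, OF s d] False
    by (intro finite_vimageI poly_roots_finite)
  moreover have "infinite (UNIV :: 'i set)"
    using infinite_Ioi finite_subset[OF subset_UNIV] by blast
  ultimately have "infinite (- (s -` {x. poly p x = 0}))" by (simp add: finite_compl)
  also have "- (s -` {x. poly p x = 0}) = N" by (auto simp: N_def)
  finally have "infinite N" .
  have ss: "v d \<le> v (s \<nu> - s \<mu>)" for \<nu> \<mu>
    using s[of \<nu> \<mu>] by (cases "\<nu> = \<mu>") (auto simp: valuation_0)
  have "v d \<le> v (x - s \<nu>)" if "x \<in> range s \<union> range t" for x \<nu>
    using that ss st by (auto simp: valuation_minus_commute[of "t _"])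
  then obtain \<nu> where \<nu>: "\<nu> \<in> N"
      "\<And>x. x \<in> range s \<union> range t \<Longrightarrow> v (poly p (s \<nu>)) \<le> v (poly p x)"
    using valuation_poly_min_on_ball[of s d N "range s \<union> range t" p] s d \<open>infinite N\<close> by blast
  show thesis
  proof (rule that)
    show "poly p (s \<nu>) \<noteq> 0" using \<nu>(1) by (simp add: N_def)
    show "\<forall>\<^sub>F \<kappa> in at_top. v (poly p (s \<kappa>)) = v (poly p (s \<nu>))"
      using s d ss \<nu>(2) by (intro eventually_valuation_poly_eq) auto
    show "\<forall>\<^sub>F \<kappa> in at_top. v (poly p (t \<kappa>)) = v (poly p (s \<nu>))"
      using t d st \<nu>(2) by (intro eventually_valuation_poly_eq) auto
  qed
qed

section \<open>Values of rational functions and membership in the domain of a sequence\<close>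

text \<open>The value may be witnessed by a representation other than \<open>Fract p q\<close>. The
  cross-multiplied form holds even where \<open>q\<close> vanishes at \<open>x\<close>.\<close>

lemma ratfun_value_Fract:
  assumes "ratfun_value (Fract p q) x y" "q \<noteq> 0"
  shows "poly p x = y * poly q x"
proof -
  from assms obtain p' q' where *: "Fract p q = Fract p' q'" "poly q' x \<noteq> 0"
      "y = poly p' x / poly q' x"
    unfolding ratfun_value_def by blast
  then have "q' \<noteq> 0" by auto
  with * assms have "p * q' = p' * q" by (metis eq_fract(1))
  then have "poly p x * poly q' x = poly p' x * poly q x" by (metis poly_mult)
  with *(2,3) show ?thesis by (metis mult.commute nonzero_mult_div_cancel_right times_divide_eq_left)
qed

lemma ratfun_value_nonneg_imp:
  assumes "ratfun_value (Fract p q) x y" "q \<noteq> 0" "0 \<le> v y"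
  shows "v (poly q x) \<le> v (poly p x)"
  using valuation_mult_mono[of 1 y "poly q x" "poly q x"] assms
  by (simp add: ratfun_value_Fract valuation_1)

lemma ratfun_value_nonneg_iff:
  assumes "poly q x \<noteq> 0"
  shows "(\<exists>y. ratfun_value (Fract p q) x y \<and> 0 \<le> v y) \<longleftrightarrow> v (poly q x) \<le> v (poly p x)"
proof
  assume "\<exists>y. ratfun_value (Fract p q) x y \<and> 0 \<le> v y"
  then show "v (poly q x) \<le> v (poly p x)"
    using assms ratfun_value_nonneg_imp by fastforce
next
  assume "v (poly q x) \<le> v (poly p x)"
  with assms show "\<exists>y. ratfun_value (Fract p q) x y \<and> 0 \<le> v y"
    unfolding ratfun_value_def by (metis valuation_divide_nonneg_iff)
qed

text \<open>As \<open>b \<noteq> 0\<close>, the value \<open>v b\<close> is finite, so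
  \<open>q\<close> eventually does not vanish along \<open>s\<close> and membership becomes a
  comparison of two constants that no longer involves \<open>s\<close>.\<close>

lemma Fract_in_seq_valuation_domain_iff:
  assumes "b \<noteq> 0"
    and "\<forall>\<^sub>F \<nu> in at_top. v (poly p (s \<nu>)) = v a"
    and "\<forall>\<^sub>F \<nu> in at_top. v (poly q (s \<nu>)) = v b"
  shows "Fract p q \<in> seq_valuation_domain {x. 0 \<le> v x} s \<longleftrightarrow> v b \<le> v a"
proof -
  have "\<forall>\<^sub>F \<nu> in at_top.
      (\<exists>y. ratfun_value (Fract p q) (s \<nu>) y \<and> 0 \<le> v y) \<longleftrightarrow> v b \<le> v a"
    using assms(2,3)
  proof eventually_elim
    case (elim \<nu>)
    with assms(1) have "poly q (s \<nu>) \<noteq> 0" by (metis valuation_eq_top_iff)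
    with elim show ?case by (simp add: ratfun_value_nonneg_iff)
  qed
  then show ?thesis
    by (simp add: seq_valuation_domain_def eventually_subst)
qed

section \<open>From equivalence to the distance conditions\<close>

text \<open>\<open>(X - a) / c\<close> and \<open>c / (X - a)\<close> both lie in the domain of
  \<open>s\<close>, hence in that of \<open>t\<close>; they give the two opposite
  inequalities.\<close>

lemma seq_valuation_domain_determines_distance:
  assumes "seq_valuation_domain {x. 0 \<le> v x} s = seq_valuation_domain {x. 0 \<le> v x} t"
    and "\<forall>\<^sub>F \<nu> in at_top. v (s \<nu> - a) = v c" "c \<noteq> 0"
  shows "\<forall>\<^sub>F \<nu> in at_top. v (t \<nu> - a) = v c"
proof -
  have "Fract [:- a, 1:] [:c:] \<in> seq_valuation_domain {x. 0 \<le> v x} s"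
    "Fract [:c:] [:- a, 1:] \<in> seq_valuation_domain {x. 0 \<le> v x} s"
    using assms(2,3) by (auto simp: Fract_in_seq_valuation_domain_iff[where a = c and b = c])
  then have "\<forall>\<^sub>F \<nu> in at_top. \<exists>y. ratfun_value (Fract [:- a, 1:] [:c:]) (t \<nu>) y \<and> 0 \<le> v y"
    "\<forall>\<^sub>F \<nu> in at_top. \<exists>y. ratfun_value (Fract [:c:] [:- a, 1:]) (t \<nu>) y \<and> 0 \<le> v y"
    using assms(1) by (auto simp: seq_valuation_domain_def)
  then show ?thesis
  proof eventually_elim
    case (elim \<nu>)
    then have "v (poly [:c:] (t \<nu>)) \<le> v (poly [:- a, 1:] (t \<nu>))"
      "v (poly [:- a, 1:] (t \<nu>)) \<le> v (poly [:c:] (t \<nu>))"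
      using assms(3) by (auto simp del: poly_pCons intro!: ratfun_value_nonneg_imp)
    then show ?case by simp
  qed
qed

lemma eventually_neq_at_top:
  "\<forall>\<^sub>F \<nu> in at_top. (\<nu> :: 'i::{linorder,no_top}) \<noteq> \<mu>"
  by (rule eventually_mono[OF eventually_gt_at_top[of \<mu>]]) auto

text \<open>Three positions of \<open>a\<close> relative to the ball around the sequence whose
  radius is the breadth: outside, all distances to \<open>a\<close> agree; inside and strictly
  nearer than the breadth to some term \<open>s \<mu>\<close>, all other terms are at the breadth;
  otherwise every term is.\<close>

lemma pseudo_stationary_eventual_distance:
  fixes s :: "'i::{wellorder,no_top} \<Rightarrow> 'k"
  assumes "pseudo_stationary v s"
  obtains c where "\<forall>\<^sub>F \<nu> in at_top. v (s \<nu> - a) = v c"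
proof (cases "\<exists>\<nu> \<mu>. \<nu> \<noteq> \<mu> \<and> v (s \<nu> - a) < v (s \<nu> - s \<mu>)")
  case True
  then obtain \<nu> \<mu> where *: "\<nu> \<noteq> \<mu>" "v (s \<nu> - a) < v (s \<nu> - s \<mu>)" by blast
  have "v (s \<kappa> - a) = v (s \<nu> - a)" for \<kappa>
  proof (cases "\<kappa> = \<nu>")
    case False
    with * assms have "v (s \<nu> - a) < v (s \<kappa> - s \<nu>)" unfolding pseudo_stationary_def by metis
    from valuation_add_eq[OF this] show ?thesis by simp
  qed simp
  then show thesis by (intro that[of "s \<nu> - a"]) simp
next
  case False
  then have ge: "v (s \<nu> - s \<mu>) \<le> v (s \<nu> - a)" if "\<nu> \<noteq> \<mu>" for \<nu> \<mu> using that by force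
  obtain \<nu>0 \<nu>1 :: 'i where ne: "\<nu>0 < \<nu>1" using gt_ex by blast
  have const: "v (s \<nu> - s \<mu>) = v (s \<nu>0 - s \<nu>1)" if "\<nu> \<noteq> \<mu>" for \<nu> \<mu>
    using assms that ne unfolding pseudo_stationary_def by (metis less_irrefl)
  show thesis
  proof (cases "\<exists>\<mu>. v (s \<nu>0 - s \<nu>1) < v (s \<mu> - a)")
    case True
    then obtain \<mu> where \<mu>: "v (s \<nu>0 - s \<nu>1) < v (s \<mu> - a)" by blast
    have "v (s \<nu> - a) = v (s \<nu>0 - s \<nu>1)" if "\<nu> \<noteq> \<mu>" for \<nu>
      using valuation_add_eq[of "s \<nu> - s \<mu>" "s \<mu> - a"] const[OF that] \<mu> by simp
    then show thesis
      by (intro that) (rule eventually_mono[OF eventually_neq_at_top])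
  next
    case False
    have "v (s \<nu> - a) = v (s \<nu>0 - s \<nu>1)" for \<nu>
    proof (rule antisym)
      show "v (s \<nu> - a) \<le> v (s \<nu>0 - s \<nu>1)" using False by (simp add: not_less)
      obtain \<mu> where "\<nu> < \<mu>" using gt_ex by blast
      with ge[of \<nu> \<mu>] const[of \<nu> \<mu>] show "v (s \<nu>0 - s \<nu>1) \<le> v (s \<nu> - a)" by simp
    qed
    then show thesis by (intro that) simp
  qed
qed

lemma equivalent_eventual_distance:
  fixes s t :: "'i::{wellorder,no_top} \<Rightarrow> 'k"
  assumes "pseudo_stationary v t"
    and eq: "seq_valuation_domain {x. 0 \<le> v x} s = seq_valuation_domain {x. 0 \<le> v x} t"
    and s: "\<forall>\<^sub>F \<nu> in at_top. v (s \<nu> - a) = v c"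
  shows "\<forall>\<^sub>F \<nu> in at_top. v (t \<nu> - a) = v c"
proof (cases "c = 0")
  case False
  with assms show ?thesis using seq_valuation_domain_determines_distance by blast
next
  case True
  obtain c' where c': "\<forall>\<^sub>F \<nu> in at_top. v (t \<nu> - a) = v c'"
    using pseudo_stationary_eventual_distance[OF assms(1)] .
  have "c' = 0"
  proof (rule ccontr)
    assume "c' \<noteq> 0"
    with eq c' have "\<forall>\<^sub>F \<nu> in at_top. v (s \<nu> - a) = v c'"
      using seq_valuation_domain_determines_distance[of t s] by simp
    with s have "\<forall>\<^sub>F \<nu>::'i in at_top. v c = v c'" by eventually_elim simp
    \<comment> \<open>The filter \<open>at_top\<close> is nontrivial, so an eventual equality of
      constants is an equality.\<close>
    then have "v c = v c'" by simp
    with True \<open>c' \<noteq> 0\<close> show False by (metis valuation_eq_top_iff)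
  qed
  with c' True show ?thesis by simp
qed

text \<open>Seen from the centre \<open>s \<mu>\<close>, the sequence \<open>s\<close> is eventually
  at its breadth, and so is \<open>t\<close> by equivalence. The reverse inequality of breadths
  comes from exchanging the sequences.\<close>

lemma equivalent_breadth_le:
  fixes s t :: "'i::{wellorder,no_top} \<Rightarrow> 'k"
  assumes s: "pseudo_stationary v s" and t: "pseudo_stationary v t"
    and eq: "seq_valuation_domain {x. 0 \<le> v x} s = seq_valuation_domain {x. 0 \<le> v x} t"
  shows "breadth v s \<le> breadth v t" "breadth v s \<le> v (s \<mu> - t \<nu>)"
proof -
  obtain \<mu>' where "\<mu> < \<mu>'" using gt_ex by blast
  define d where "d = s \<mu>' - s \<mu>"
  have d: "breadth v s = v d" using breadth_eq[OF s] \<open>\<mu> < \<mu>'\<close> by (simp add: d_def)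
  have "v (s \<nu> - s \<mu>) = v d" if "\<nu> \<noteq> \<mu>" for \<nu>
    using breadth_eq[OF s that] d by simp
  then have "\<forall>\<^sub>F \<nu> in at_top. v (s \<nu> - s \<mu>) = v d"
    by (rule eventually_mono[OF eventually_neq_at_top])
  then have "\<forall>\<^sub>F \<nu> in at_top. v (t \<nu> - s \<mu>) = v d"
    by (rule equivalent_eventual_distance[OF t eq])
  then obtain N where N: "\<And>\<nu>. N \<le> \<nu> \<Longrightarrow> v (t \<nu> - s \<mu>) = v d"
    unfolding eventually_at_top_linorder by blast
  obtain N' where N': "N < N'" using gt_ex by blast
  \<comment> \<open>The difference of two distinct late terms of \<open>t\<close> has the breadth of
    \<open>t\<close> as its value.\<close>
  have "v d \<le> v ((t N - s \<mu>) - (t N' - s \<mu>))"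
    using N[of N] N[of N'] N' by (intro valuation_diff_ge[of _ "t N - s \<mu>"]) auto
  then show le: "breadth v s \<le> breadth v t"
    using breadth_eq[OF t, of N N'] N' d by simp
  show "breadth v s \<le> v (s \<mu> - t \<nu>)"
  proof (cases "\<nu> = N")
    case True
    with N[of N] d show ?thesis by (simp add: valuation_minus_commute)
  next
    case False
    \<comment> \<open>An arbitrary, possibly early, term \<open>t \<nu>\<close> is reached through
      the late term \<open>t N\<close>.\<close>
    have "breadth v s \<le> v ((t \<nu> - t N) + (t N - s \<mu>))"
      using le breadth_eq[OF t False] N[of N] d by (intro valuation_add_ge) auto
    then show ?thesis by (simp add: valuation_minus_commute)
  qed
qed

section \<open>From the distance conditions to equivalence\<close>

lemma seq_valuation_domain_eqI:
  fixes s t :: "'i::{wellorder,no_top} \<Rightarrow> 'k"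
  assumes s: "\<And>\<nu> \<mu>. \<nu> \<noteq> \<mu> \<Longrightarrow> v (s \<nu> - s \<mu>) = v d"
    and t: "\<And>\<nu> \<mu>. \<nu> \<noteq> \<mu> \<Longrightarrow> v (t \<nu> - t \<mu>) = v d"
    and st: "\<And>\<nu> \<mu>. v d \<le> v (s \<nu> - t \<mu>)"
  shows "seq_valuation_domain {x. 0 \<le> v x} s = seq_valuation_domain {x. 0 \<le> v x} t"
proof (cases "d = 0")
  case True
  \<comment> \<open>Here the breadth is infinite, so the distance bound forces the terms to
    coincide.\<close>
  have "s \<nu> = t \<nu>" for \<nu>
    using st[of \<nu> \<nu>] True
    by (simp add: valuation_0 valuation_eq_top_iff)
  then have "s = t" ..
  then show ?thesis by simp
next
  case False
  show ?thesis
  proof (intro set_eqI)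
    fix \<phi> :: "'k poly fract"
    obtain p q where \<phi>: "\<phi> = Fract p q" "q \<noteq> 0" by (cases \<phi>) auto
    \<comment> \<open>Numerator and denominator each get one eventual value shared by
      \<open>s\<close> and \<open>t\<close>, so the membership criterion is the same for both
      sequences.\<close>
    note common = eventually_valuation_poly_common[of s d t, OF s t st False]
    obtain a where a: "\<forall>\<^sub>F \<nu> in at_top. v (poly p (s \<nu>)) = v (poly p a)"
      "\<forall>\<^sub>F \<nu> in at_top. v (poly p (t \<nu>)) = v (poly p a)"
      using common[of p] by blast
    obtain b where b: "poly q b \<noteq> 0"
      "\<forall>\<^sub>F \<nu> in at_top. v (poly q (s \<nu>)) = v (poly q b)"
      "\<forall>\<^sub>F \<nu> in at_top. v (poly q (t \<nu>)) = v (poly q b)"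
      using common[of q] \<phi>(2) by blast
    show "\<phi> \<in> seq_valuation_domain {x. 0 \<le> v x} s \<longleftrightarrow>
        \<phi> \<in> seq_valuation_domain {x. 0 \<le> v x} t"
      unfolding \<phi>(1) using a b \<phi>(2) by (simp add: Fract_in_seq_valuation_domain_iff)
  qed
qed

end

theorem proposition5p5:
  fixes V :: "'k::field set"
    and v :: "'k \<Rightarrow> 'g::linordered_ab_group_add extended"
    and s t :: "'i::{wellorder,no_top} \<Rightarrow> 'k"
  assumes "valuation_domain V"
    and "valuation_of V v"
    and "pseudo_stationary v s"
    and "pseudo_stationary v t"
  shows "equivalent_seqs V s t \<longleftrightarrow>
    (\<exists>\<delta>. breadth v s = \<delta> \<and> breadth v t = \<delta> \<and> (\<forall>\<nu> \<mu>. \<delta> \<le> v (s \<nu> - t \<mu>)))"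
proof
  from assms(2) have v: "valuation v" and V: "V = {x. 0 \<le> v x}"
    by (auto simp: valuation_of_def)
  {
    assume "equivalent_seqs V s t"
    then have eq: "seq_valuation_domain {x. 0 \<le> v x} s = seq_valuation_domain {x. 0 \<le> v x} t"
      by (simp add: equivalent_seqs_def V)
    have "breadth v s = breadth v t"
      using equivalent_breadth_le(1)[OF v assms(3,4) eq]
        equivalent_breadth_le(1)[OF v assms(4,3) eq[symmetric]] by simp
    with equivalent_breadth_le(2)[OF v assms(3,4) eq]
    show "\<exists>\<delta>. breadth v s = \<delta> \<and> breadth v t = \<delta> \<and> (\<forall>\<nu> \<mu>. \<delta> \<le> v (s \<nu> - t \<mu>))" by auto
  next
    assume "\<exists>\<delta>. breadth v s = \<delta> \<and> breadth v t = \<delta> \<and> (\<forall>\<nu> \<mu>. \<delta> \<le> v (s \<nu> - t \<mu>))"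
    then have \<delta>: "breadth v t = breadth v s" "\<And>\<nu> \<mu>. breadth v s \<le> v (s \<nu> - t \<mu>)" by auto
    \<comment> \<open>Two distinct indices supply a field element whose value is the common breadth,
      as the bounds on polynomials require.\<close>
    obtain \<nu>0 \<nu>1 :: 'i where "\<nu>0 < \<nu>1" using gt_ex by blast
    then have d: "breadth v s = v (s \<nu>0 - s \<nu>1)" by (simp add: breadth_eq[OF assms(3)])
    have "seq_valuation_domain {x. 0 \<le> v x} s = seq_valuation_domain {x. 0 \<le> v x} t"
    proof (rule seq_valuation_domain_eqI[OF v])
      show "v (s \<nu> - s \<mu>) = v (s \<nu>0 - s \<nu>1)" if "\<nu> \<noteq> \<mu>" for \<nu> \<mu>
        using breadth_eq[OF assms(3) that] d by simp
      show "v (t \<nu> - t \<mu>) = v (s \<nu>0 - s \<nu>1)" if "\<nu> \<noteq> \<mu>" for \<nu> \<mu>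
        using breadth_eq[OF assms(4) that] \<delta>(1) d by simp
      show "v (s \<nu>0 - s \<nu>1) \<le> v (s \<nu> - t \<mu>)" for \<nu> \<mu>
        using \<delta>(2) d by simp
    qed
    then show "equivalent_seqs V s t" by (simp add: equivalent_seqs_def V)
  }
qed

end
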